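(* Let $a\ge 2$, $b\ge 2$, $a_1>0$ and $c\in(0,0.75)$ be constants, and let $\mathbb{K}$ be $\mathbb{R}$ or $\mathbb{C}$. Let $h:\mathbb{K}\to\mathbb{K}$ be continuously differentiable with $$|h(u)|\le c|u|^{b},\qquad |h'(u)|\le c|u|^{b-1}\qquad\text{for all }u\in\mathbb{K},$$ and let $f:[0,\infty)\to\mathbb{K}$ be continuously differentiable with $$|f'(t)|+a|f(t)|\le c\,e^{-a_1 t}\qquad\text{for all }t\ge 0.$$ Let $R=(b-1)^{1/b}$ and let $p\in(0,\min(0.25\,a,\,a_1))$. Then any solution $u$ of the equation $$u(t)=\int_0^t e^{-a(t-s)}h(u(s))\,ds+f(t),\qquad t\ge 0,$$ exists on all of $[0,\infty)$ and satisfies $$|u(t)|\le R^{-1}e^{-pt}\qquad\text{for all }t\ge 0.$$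
   Context: The unknown $u$ is a continuous $\mathbb{K}$-valued function. A solution on an interval $[0,\tau)$, $0<\tau\le\infty$, is a continuous function $u:[0,\tau)\to\mathbb{K}$ satisfying the integral equation for every $t\in[0,\tau)$. "Any solution exists on all of $[0,\infty)$" means that every solution on an interval $[0,\tau)$ extends to a solution on $[0,\infty)$ (equivalently, maximally extended solutions are defined on all of $[0,\infty)$). Here $f'=df/dt$ and $h'$ is the derivative of $h$. When $\mathbb{K}=\mathbb{C}$, $h$ is regarded as a continuously differentiable map of $\mathbb{R}^2$ to itself and $|h'(u)|$ is the operator norm of its derivative. *)

theory Defs
  imports "HOL-Analysis.Analysis"
begin

definition time_dom :: "ereal \<Rightarrow> real set" where
  "time_dom \<tau> = {t. 0 \<le> t \<and> ereal t < \<tau>}"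

text \<open>
  Only the values of \<open>u\<close> on \<open>time_dom \<tau>\<close> matter. The endpoint \<open>\<tau> = \<infinity>\<close> gives
  solutions on the whole half-line.
\<close>

definition solution :: "real \<Rightarrow> ('k::euclidean_space \<Rightarrow> 'k) \<Rightarrow> (real \<Rightarrow> 'k) \<Rightarrow> ereal \<Rightarrow> (real \<Rightarrow> 'k) \<Rightarrow> bool"
  where
  "solution a h f \<tau> u \<longleftrightarrow>
     continuous_on (time_dom \<tau>) u \<and>
     (\<forall>t\<in>time_dom \<tau>. u t = integral {0..t} (\<lambda>s. exp (- a * (t - s)) *\<^sub>R h (u s)) + f t)"

end

theory Submission imports Defs begin

text \<open>
  Since \<open>f' + a f\<close> is of size at most \<open>c exp (- a1 t)\<close>, variation of constants turns the equation into
  \<open>u t = exp (- a t) f 0 + \<integral> exp (- a (t - s)) (h (u s) + f' s + a f s) ds\<close>. With \<open>W = 1 / R\<close>, as long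
  as \<open>|u| \<le> W exp (- p s)\<close> the last integrand is at most \<open>c (W\<^sup>b + 1) exp (- p s) \<le> (a - p) W exp (- p s)\<close>,
  which together with \<open>|f 0| < W\<close> gives strict inequality at time \<open>t\<close>; so the bound is never reached.
  On the ball of radius \<open>W\<close> the Lipschitz constant of \<open>h\<close> is below \<open>a\<close>, so after truncating \<open>h\<close>
  outside that ball the integral operator is a contraction for the supremum norm on the whole half-line.
\<close>

section \<open>Estimates for convolution with the exponential kernel\<close>

text \<open>The bound on \<open>g\<close> dominates the integrand by
  \<open>M * exp (- a * t + (a - p) * s)\<close>, whose antiderivative is explicit. The subtracted
  \<open>exp (- a * t)\<close> is kept because it leaves the room that the initial value
  \<open>f 0\<close> takes up in the decay estimate.\<close>

lemma exp_kernel_norm_le: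
  fixes g :: "real \<Rightarrow> 'a::euclidean_space"
  assumes "p < a" "0 \<le> t"
    and int: "(\<lambda>s. exp (- a * (t - s)) *\<^sub>R g s) integrable_on {0..t}"
    and bound: "\<And>s. s \<in> {0..t} \<Longrightarrow> norm (g s) \<le> M * exp (- p * s)"
  shows "norm (integral {0..t} (\<lambda>s. exp (- a * (t - s)) *\<^sub>R g s))
    \<le> M / (a - p) * (exp (- p * t) - exp (- a * t))"
proof -
  define F where "F s = M / (a - p) * exp (- a * t + (a - p) * s)" for s
  have I: "((\<lambda>s. M * exp (- a * t + (a - p) * s)) has_integral F t - F 0) {0..t}"
  proof (rule fundamental_theorem_of_calculus[OF \<open>0 \<le> t\<close>])
    fix s
    have "(F has_real_derivative M / (a - p) * (exp (- a * t + (a - p) * s) * (a - p)))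
        (at s within {0..t})"
      unfolding F_def by (auto intro!: derivative_eq_intros)
    then show "(F has_vector_derivative M * exp (- a * t + (a - p) * s)) (at s within {0..t})"
      using \<open>p < a\<close> by (simp add: has_real_derivative_iff_has_vector_derivative)
  qed
  have le: "norm (exp (- a * (t - s)) *\<^sub>R g s) \<le> M * exp (- a * t + (a - p) * s)"
    if "s \<in> {0..t}" for s
  proof -
    have "exp (- a * (t - s)) * norm (g s) \<le> exp (- a * (t - s)) * (M * exp (- p * s))"
      using bound[OF that] by simp
    also have "\<dots> = M * exp (- a * t + (a - p) * s)"
      by (simp add: exp_add[symmetric] algebra_simps)
    finally show ?thesis by simp
  qed
  have "norm (integral {0..t} (\<lambda>s. exp (- a * (t - s)) *\<^sub>R g s)) \<le> F t - F 0"
    using integral_norm_bound_integral[OF int has_integral_integrable[OF I] le] integral_unique[OF I]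
    by simp
  also have "\<dots> = M / (a - p) * (exp (- p * t) - exp (- a * t))"
    by (simp add: F_def algebra_simps)
  finally show ?thesis .
qed

lemma exp_kernel_integrable:
  fixes g :: "real \<Rightarrow> 'a::euclidean_space"
  assumes "continuous_on {0..t} g"
  shows "(\<lambda>s. exp (- a * (t - s)) *\<^sub>R g s) integrable_on {0..t}"
  by (intro integrable_continuous_interval continuous_intros assms)

text \<open>The case \<open>p = 0\<close>. The factor \<open>1 / a\<close> does not grow with
  \<open>t\<close>, which is what permits a contraction on an unbounded time interval.\<close>

lemma exp_kernel_norm_le_uniform:
  fixes g :: "real \<Rightarrow> 'a::euclidean_space"
  assumes "0 < a" "0 \<le> t" "continuous_on {0..t} g"
    and bound: "\<And>s. s \<in> {0..t} \<Longrightarrow> norm (g s) \<le> M"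
  shows "norm (integral {0..t} (\<lambda>s. exp (- a * (t - s)) *\<^sub>R g s)) \<le> M / a"
proof -
  have "norm (integral {0..t} (\<lambda>s. exp (- a * (t - s)) *\<^sub>R g s))
      \<le> M / (a - 0) * (exp (- 0 * t) - exp (- a * t))"
    by (rule exp_kernel_norm_le[OF assms(1,2) exp_kernel_integrable[OF assms(3)]]) (simp add: bound)
  then have "norm (integral {0..t} (\<lambda>s. exp (- a * (t - s)) *\<^sub>R g s)) \<le> M / a * (1 - exp (- a * t))"
    by simp
  also have "norm (g 0) \<le> M"
    using bound \<open>0 \<le> t\<close> by simp
  then have "0 \<le> M"
    by (rule order_trans[OF norm_ge_zero])
  then have "M / a * (1 - exp (- a * t)) \<le> M / a * 1"
    using \<open>0 < a\<close> by (intro mult_left_mono) auto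
  finally show ?thesis by simp
qed

text \<open>Integrates the \<open>s\<close>-derivative of
  \<open>exp (- a * (t - s)) *\<^sub>R f s\<close>. This trades \<open>f t\<close> for
  \<open>f 0\<close> and the combination \<open>f' s + a *\<^sub>R f s\<close>, whose norm the decay
  hypothesis on the forcing term controls.\<close>

lemma exp_kernel_variation_of_constants:
  fixes f :: "real \<Rightarrow> 'a::euclidean_space"
  assumes "0 \<le> t"
    and "\<And>s. 0 \<le> s \<Longrightarrow> (f has_vector_derivative f' s) (at s within {0..})"
  shows "((\<lambda>s. exp (- a * (t - s)) *\<^sub>R (f' s + a *\<^sub>R f s)) has_integral
    f t - exp (- a * t) *\<^sub>R f 0) {0..t}"
proof -
  define F where "F s = exp (- a * (t - s)) *\<^sub>R f s" for s
  have "((\<lambda>s. exp (- a * (t - s)) *\<^sub>R (f' s + a *\<^sub>R f s)) has_integral F t - F 0) {0..t}"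
  proof (rule fundamental_theorem_of_calculus[OF \<open>0 \<le> t\<close>])
    fix s assume s: "s \<in> {0..t}"
    have f: "(f has_vector_derivative f' s) (at s within {0..t})"
      using has_vector_derivative_within_subset[OF assms(2)[of s], of "{0..t}"] s by auto
    have e: "((\<lambda>s. exp (- a * (t - s))) has_real_derivative exp (- a * (t - s)) * a)
        (at s within {0..t})"
      by (auto intro!: derivative_eq_intros)
    show "(F has_vector_derivative exp (- a * (t - s)) *\<^sub>R (f' s + a *\<^sub>R f s)) (at s within {0..t})"
      unfolding F_def using has_vector_derivative_scaleR[OF e f] by (simp add: algebra_simps)
  qed
  then show ?thesis by (simp add: F_def)
qed

section \<open>A priori decay of solutions\<close>

text \<open>The bootstrap step, with \<open>g\<close> in the role of the nonlinearity along
  \<open>u\<close>. The integral contributes at most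
  \<open>W * (exp (- p * t) - exp (- a * t))\<close> and the initial value less than
  \<open>exp (- a * t) * W\<close>; these add up to the claim, and strictness comes from
  \<open>norm (f 0) < W\<close>.\<close>

lemma exp_decay_comparison:
  fixes u f g :: "real \<Rightarrow> 'a::euclidean_space"
  assumes "p < a" "0 \<le> t" "0 \<le> W" "c * (W powr b + 1) \<le> (a - p) * W" "0 \<le> c"
    and "1 \<le> b" "0 \<le> p" "p \<le> a1"
    and cont: "continuous_on {0..t} u" "continuous_on {0..t} g"
    and eq: "u t = integral {0..t} (\<lambda>s. exp (- a * (t - s)) *\<^sub>R g s) + f t"
    and f: "\<And>s. 0 \<le> s \<Longrightarrow> (f has_vector_derivative f' s) (at s within {0..})"
    and f0: "norm (f 0) < W"
    and f_le: "\<And>s. 0 \<le> s \<Longrightarrow> norm (f' s) + a * norm (f s) \<le> c * exp (- a1 * s)"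
    and g_le: "\<And>s. s \<in> {0..t} \<Longrightarrow> norm (g s) \<le> c * norm (u s) powr b"
    and u_le: "\<And>s. s \<in> {0..t} \<Longrightarrow> norm (u s) \<le> W * exp (- p * s)"
  shows "norm (u t) < W * exp (- p * t)"
proof -
  let ?k = "\<lambda>s. exp (- a * (t - s))"
  \<comment> \<open>Nonlinearity and forcing are gathered so that a single kernel estimate covers
    both.\<close>
  define q where "q s = g s + (f' s + a *\<^sub>R f s)" for s
  have a: "0 < a" using assms by simp
  have q: "((\<lambda>s. ?k s *\<^sub>R q s) has_integral
      integral {0..t} (\<lambda>s. ?k s *\<^sub>R g s) + (f t - exp (- a * t) *\<^sub>R f 0)) {0..t}"
    unfolding q_def scaleR_add_right[of "?k _" "g _"]
    by (intro has_integral_add integrable_integral exp_kernel_integrable cont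
        exp_kernel_variation_of_constants \<open>0 \<le> t\<close> f)
  have q_le: "norm (q s) \<le> c * (W powr b + 1) * exp (- p * s)" if s: "s \<in> {0..t}" for s
  proof -
    have "norm (u s) powr b \<le> (W * exp (- p * s)) powr b"
      using u_le[OF s] assms by (intro powr_mono2) auto
    also have "\<dots> = W powr b * exp (- p * b * s)"
      by (simp add: powr_mult exp_powr_real mult_ac)
    \<comment> \<open>The power \<open>b\<close> only speeds up the decay, as
      \<open>1 \<le> b\<close> and \<open>0 \<le> p * s\<close>; rate \<open>p\<close> is
      enough.\<close>
    also have "\<dots> \<le> W powr b * exp (- p * s)"
    proof -
      have "p * s * 1 \<le> p * s * b"
        using assms s by (intro mult_left_mono) auto
      then show ?thesis by (intro mult_left_mono) (auto simp: mult_ac)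
    qed
    finally have "norm (g s) \<le> c * (W powr b * exp (- p * s))"
      using g_le[OF s] \<open>0 \<le> c\<close> by (meson mult_left_mono order_trans)
    moreover have "norm (f' s + a *\<^sub>R f s) \<le> c * exp (- a1 * s)"
      using f_le[of s] s a norm_triangle_ineq[of "f' s" "a *\<^sub>R f s"] by simp
    moreover have "c * exp (- a1 * s) \<le> c * exp (- p * s)"
      using \<open>0 \<le> c\<close> \<open>p \<le> a1\<close> s by (intro mult_left_mono) (auto intro: mult_right_mono)
    ultimately have "norm (g s) + norm (f' s + a *\<^sub>R f s) \<le> c * (W powr b + 1) * exp (- p * s)"
      by (simp add: algebra_simps)
    then show ?thesis
      unfolding q_def using norm_triangle_ineq order_trans by blast
  qed
  have "u t = integral {0..t} (\<lambda>s. ?k s *\<^sub>R q s) + exp (- a * t) *\<^sub>R f 0"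
    using eq integral_unique[OF q] by simp
  then have "norm (u t) \<le> norm (integral {0..t} (\<lambda>s. ?k s *\<^sub>R q s)) + exp (- a * t) * norm (f 0)"
    by (metis abs_exp_cancel norm_scaleR norm_triangle_ineq)
  also have "norm (integral {0..t} (\<lambda>s. ?k s *\<^sub>R q s))
      \<le> c * (W powr b + 1) / (a - p) * (exp (- p * t) - exp (- a * t))"
    by (rule exp_kernel_norm_le[OF \<open>p < a\<close> \<open>0 \<le> t\<close> has_integral_integrable[OF q] q_le])
  also have "\<dots> \<le> W * (exp (- p * t) - exp (- a * t))"
    using assms by (intro mult_right_mono) (auto simp: field_simps mult_right_mono)
  also have "exp (- a * t) * norm (f 0) < exp (- a * t) * W"
    using f0 by simp
  finally show ?thesis by (simp add: algebra_simps)
qed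

text \<open>First-violation argument: before the earliest violation \<open>r\<close> the bound holds
  strictly, by continuity it holds weakly up to \<open>r\<close>, and the bootstrap step makes it
  strict at \<open>r\<close>, a contradiction.\<close>

lemma exp_decay_bound:
  fixes u f :: "real \<Rightarrow> 'a::euclidean_space"
  assumes "p < a" "0 \<le> W" "c * (W powr b + 1) \<le> (a - p) * W" "0 \<le> c" "1 \<le> b" "0 \<le> p" "p \<le> a1"
    and cont: "continuous_on {0..T} u" "continuous_on UNIV h"
    and eq: "\<And>t. t \<in> {0..T} \<Longrightarrow>
      u t = integral {0..t} (\<lambda>s. exp (- a * (t - s)) *\<^sub>R h (u s)) + f t"
    and f: "\<And>s. 0 \<le> s \<Longrightarrow> (f has_vector_derivative f' s) (at s within {0..})"
    and f0: "norm (f 0) < W"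
    and f_le: "\<And>s. 0 \<le> s \<Longrightarrow> norm (f' s) + a * norm (f s) \<le> c * exp (- a1 * s)"
    and h_le: "\<And>x. norm (h x) \<le> c * norm x powr b"
    and t: "t \<in> {0..T}"
  shows "norm (u t) < W * exp (- p * t)"
proof (rule ccontr)
  \<comment> \<open>The weak inequality makes \<open>S\<close> closed, hence compact, so an earliest
    violation exists.\<close>
  define S where "S = {t \<in> {0..T}. W * exp (- p * t) \<le> norm (u t)}"
  assume "\<not> norm (u t) < W * exp (- p * t)"
  then have "t \<in> S" using t by (auto simp: S_def)
  moreover have "compact S"
  proof -
    have "closed S"
      unfolding S_def by (intro continuous_on_closed_Collect_le continuous_intros cont)
    moreover have "S = {0..T} \<inter> S" by (auto simp: S_def)
    ultimately show ?thesis using compact_Int_closed[OF compact_Icc] by metis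
  qed
  ultimately obtain r where r: "r \<in> S" "\<And>s. s \<in> S \<Longrightarrow> r \<le> s"
    using compact_attains_inf[of S] by blast
  then have r0: "0 \<le> r" "r \<le> T" "W * exp (- p * r) \<le> norm (u r)" by (auto simp: S_def)
  have below: "norm (u s) < W * exp (- p * s)" if "s \<in> {0..<r}" for s
    using r(2)[of s] that r0 by (force simp: S_def)
  \<comment> \<open>The integral vanishes at time 0, so \<open>norm (f 0) < W\<close> excludes
    \<open>r = 0\<close>. Hence \<open>{0..<r}\<close> has closure \<open>{0..r}\<close>, to which
    the bound passes.\<close>
  have "u 0 = f 0" using eq[of 0] t by simp
  then have "0 < r" using f0 r0 by (cases "r = 0") auto
  have contr: "continuous_on {0..r} u"
    using cont(1) r0 by (rule_tac continuous_on_subset) auto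
  have "norm (u s) \<le> W * exp (- p * s)" if "s \<in> {0..r}" for s
  proof -
    have cl: "closure {0..<r} = {0..r}" using \<open>0 < r\<close> by simp
    have "norm (u s) - W * exp (- p * s) \<le> 0"
      by (rule continuous_le_on_closure[of "{0..<r}" "\<lambda>s. norm (u s) - W * exp (- p * s)"])
        (use cl that below contr in \<open>auto intro!: continuous_intros simp: less_imp_le\<close>)
    then show ?thesis by simp
  qed
  then have "norm (u r) < W * exp (- p * r)"
    using assms r0 contr
    by (intro exp_decay_comparison[where g = "\<lambda>s. h (u s)", OF _ _ _ _ _ _ _ _ _ _ _ f f0 f_le])
      (auto intro: continuous_on_compose2[OF cont(2)])
  then show False using r0 by simp
qed

section \<open>Well-posedness for Lipschitz nonlinearities\<close>

lemma continuous_on_atLeastI: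
  fixes v :: "real \<Rightarrow> 'a::topological_space"
  assumes "\<And>T. 0 \<le> T \<Longrightarrow> continuous_on {0..T} v"
  shows "continuous_on {0..} v"
  unfolding continuous_on_eq_continuous_within
proof
  fix t :: real assume "t \<in> {0..}"
  then have "continuous (at t within {0..t + 1}) v"
    using assms[of "t + 1"] by (auto simp: continuous_on_eq_continuous_within)
  moreover have "at t within {0..t + 1} = at t within {0..}"
    by (rule at_within_nhd[of t "{..<t + 1}"]) auto
  ultimately show "continuous (at t within {0..}) v" by simp
qed

text \<open>The kernel splits as \<open>exp (- a * t)\<close> times \<open>exp (a * s)\<close>, so
  \<open>t\<close> leaves the integrand and continuity of indefinite integrals applies.\<close>

lemma exp_kernel_continuous:
  fixes g :: "real \<Rightarrow> 'a::euclidean_space"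
  assumes "continuous_on {0..} g"
  shows "continuous_on {0..} (\<lambda>t. integral {0..t} (\<lambda>s. exp (- a * (t - s)) *\<^sub>R g s))"
proof (rule continuous_on_atLeastI)
  fix T :: real assume "0 \<le> T"
  have "continuous_on {0..T} (\<lambda>s. exp (a * s) *\<^sub>R g s)"
    by (intro continuous_intros continuous_on_subset[OF assms]) auto
  then have "(\<lambda>s. exp (a * s) *\<^sub>R g s) integrable_on {0..T}"
    by (rule integrable_continuous_interval)
  then have "continuous_on {0..T} (\<lambda>t. exp (- a * t) *\<^sub>R integral {0..t} (\<lambda>s. exp (a * s) *\<^sub>R g s))"
    by (intro continuous_intros indefinite_integral_continuous_1)
  moreover have "exp (- a * t) *\<^sub>R integral {0..t} (\<lambda>s. exp (a * s) *\<^sub>R g s)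
      = integral {0..t} (\<lambda>s. exp (- a * (t - s)) *\<^sub>R g s)" for t
    by (simp flip: integral_cmul add: exp_add[symmetric] algebra_simps)
  ultimately show "continuous_on {0..T} (\<lambda>t. integral {0..t} (\<lambda>s. exp (- a * (t - s)) *\<^sub>R g s))"
    by simp
qed

text \<open>The uniform kernel bound applied to the difference of the two nonlinear terms. The
  factor \<open>L / a\<close> is independent of \<open>t\<close> and is below 1 when
  \<open>L < a\<close>.\<close>

lemma exp_kernel_diff_le:
  fixes u v :: "real \<Rightarrow> 'a::euclidean_space" and h :: "'a \<Rightarrow> 'b::euclidean_space"
  assumes "0 < a" "0 \<le> t" "0 \<le> L" and h: "L-lipschitz_on UNIV h"
    and cont: "continuous_on {0..t} u" "continuous_on {0..t} v"
    and D: "\<And>s. s \<in> {0..t} \<Longrightarrow> norm (u s - v s) \<le> D"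
  shows "norm (integral {0..t} (\<lambda>s. exp (- a * (t - s)) *\<^sub>R h (u s))
    - integral {0..t} (\<lambda>s. exp (- a * (t - s)) *\<^sub>R h (v s))) \<le> L / a * D"
proof -
  note ch = continuous_on_compose2[OF lipschitz_on_continuous_on[OF h]]
  have "norm (h (u s) - h (v s)) \<le> L * D" if "s \<in> {0..t}" for s
    using lipschitz_on_normD[OF h, of "u s" "v s"] D[OF that] \<open>0 \<le> L\<close>
    by (meson UNIV_I mult_left_mono order_trans)
  then have "norm (integral {0..t} (\<lambda>s. exp (- a * (t - s)) *\<^sub>R (h (u s) - h (v s)))) \<le> L * D / a"
    using assms by (intro exp_kernel_norm_le_uniform continuous_intros ch) auto
  moreover have "integral {0..t} (\<lambda>s. exp (- a * (t - s)) *\<^sub>R h (u s))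
      - integral {0..t} (\<lambda>s. exp (- a * (t - s)) *\<^sub>R h (v s))
      = integral {0..t} (\<lambda>s. exp (- a * (t - s)) *\<^sub>R (h (u s) - h (v s)))"
    unfolding scaleR_diff_right
    by (rule integral_diff[symmetric]) (intro exp_kernel_integrable ch cont subset_UNIV)+
  ultimately show ?thesis by simp
qed

text \<open>At a point \<open>r\<close> where the difference is largest, its norm is at most
  \<open>L / a\<close> times itself; since \<open>L / a < 1\<close>, it vanishes.\<close>

lemma exp_kernel_unique:
  fixes u v :: "real \<Rightarrow> 'a::euclidean_space"
  assumes "0 \<le> L" "L < a" and h: "L-lipschitz_on UNIV h"
    and cont: "continuous_on {0..T} u" "continuous_on {0..T} v"
    and u: "\<And>t. t \<in> {0..T} \<Longrightarrow>
      u t = integral {0..t} (\<lambda>s. exp (- a * (t - s)) *\<^sub>R h (u s)) + f t"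
    and v: "\<And>t. t \<in> {0..T} \<Longrightarrow>
      v t = integral {0..t} (\<lambda>s. exp (- a * (t - s)) *\<^sub>R h (v s)) + f t"
    and t: "t \<in> {0..T}"
  shows "u t = v t"
proof -
  obtain r where r: "r \<in> {0..T}" "\<And>s. s \<in> {0..T} \<Longrightarrow> norm (u s - v s) \<le> norm (u r - v r)"
  proof -
    have "continuous_on {0..T} (\<lambda>s. norm (u s - v s))"
      by (intro continuous_intros cont)
    then show thesis
      using continuous_attains_sup[of "{0..T}" "\<lambda>s. norm (u s - v s)"] t that by auto
  qed
  have "norm (u r - v r) \<le> L / a * norm (u r - v r)"
  proof -
    have "continuous_on {0..r} u" "continuous_on {0..r} v"
      using cont r(1) by (auto intro: continuous_on_subset)
    then have "norm (integral {0..r} (\<lambda>s. exp (- a * (r - s)) *\<^sub>R h (u s))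
        - integral {0..r} (\<lambda>s. exp (- a * (r - s)) *\<^sub>R h (v s))) \<le> L / a * norm (u r - v r)"
      using assms(1,2) r by (intro exp_kernel_diff_le h) auto
    moreover have "u r - v r = integral {0..r} (\<lambda>s. exp (- a * (r - s)) *\<^sub>R h (u s))
        - integral {0..r} (\<lambda>s. exp (- a * (r - s)) *\<^sub>R h (v s))"
      by (subst u[OF r(1)], subst v[OF r(1)]) simp
    ultimately show ?thesis by simp
  qed
  moreover have "L / a < 1" using assms(1,2) by simp
  ultimately have "\<not> 0 < norm (u r - v r)"
    using mult_strict_right_mono[of "L / a" 1 "norm (u r - v r)"] by linarith
  then show ?thesis using r(2)[OF t] by simp
qed

text \<open>Banach's fixed point theorem in the space of bounded continuous functions. The bounds on
  \<open>h\<close> and \<open>f\<close> keep the integral operator inside that space.\<close>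

lemma exp_kernel_global_existence:
  fixes f :: "real \<Rightarrow> 'a::euclidean_space"
  assumes "0 \<le> L" "L < a" and h: "L-lipschitz_on UNIV h" and h_le: "\<And>x. norm (h x) \<le> M"
    and f: "continuous_on {0..} f" and f_le: "\<And>t. 0 \<le> t \<Longrightarrow> norm (f t) \<le> N"
  obtains v where "continuous_on {0..} v"
    and "\<And>t. 0 \<le> t \<Longrightarrow> v t = integral {0..t} (\<lambda>s. exp (- a * (t - s)) *\<^sub>R h (v s)) + f t"
proof -
  define E where "E v t = integral {0..t} (\<lambda>s. exp (- a * (t - s)) *\<^sub>R h (v s)) + f t" for v t
  \<comment> \<open>Bounded continuous functions here live on the whole real line;
    \<open>max t 0\<close> extends the values on the half-line by a constant to negative
    times.\<close>
  define \<Phi> where "\<Phi> v = Bcontfun (\<lambda>t. E (apply_bcontfun v) (max t 0))" for v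
  have a: "0 < a" using assms by simp
  note ch = continuous_on_compose2[OF lipschitz_on_continuous_on[OF h]]
  have cont: "continuous_on {0..} (E (apply_bcontfun v))" for v
    unfolding E_def by (intro continuous_intros exp_kernel_continuous ch f) auto
  have \<Phi>: "apply_bcontfun (\<Phi> v) t = E (apply_bcontfun v) (max t 0)" for v t
  proof -
    have "continuous_on UNIV (\<lambda>t. E (apply_bcontfun v) (max t 0))"
      by (rule continuous_on_compose2[OF cont]) (auto intro!: continuous_intros)
    moreover have "norm (E (apply_bcontfun v) (max t 0)) \<le> M / a + N" for t
      unfolding E_def using a h_le
      by (intro norm_triangle_le add_mono exp_kernel_norm_le_uniform f_le ch) auto
    ultimately have "(\<lambda>t. E (apply_bcontfun v) (max t 0)) \<in> bcontfun"
      by (auto simp: bcontfun_def bounded_iff)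
    then show ?thesis by (simp add: \<Phi>_def Bcontfun_inverse)
  qed
  have "dist (\<Phi> v) (\<Phi> w) \<le> L / a * dist v w" for v w
  proof (rule dist_bound)
    fix t
    have "norm (apply_bcontfun v s - apply_bcontfun w s) \<le> dist v w" for s
      using dist_bounded[of v s w] by (simp add: dist_norm)
    then show "dist (apply_bcontfun (\<Phi> v) t) (apply_bcontfun (\<Phi> w) t) \<le> L / a * dist v w"
      using exp_kernel_diff_le[OF a _ \<open>0 \<le> L\<close> h, of "max t 0" "apply_bcontfun v" "apply_bcontfun w" "dist v w"]
      by (simp add: \<Phi> E_def dist_norm)
  qed
  then have "\<exists>!v. \<Phi> v = v"
    using assms a by (intro banach_fix_type[where c = "L / a"]) auto
  then obtain v where "\<Phi> v = v" by auto
  then have "apply_bcontfun v t = E (apply_bcontfun v) t" if "0 \<le> t" for t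
    using \<Phi>[of v t] that by simp
  then show thesis
    using that[of "apply_bcontfun v"] by (auto simp: E_def)
qed

section \<open>Truncation outside a ball\<close>

text \<open>The mean value inequality on the convex ball gives constant \<open>L\<close> there, and
  the projection onto the ball is nonexpansive.\<close>

lemma lipschitz_closest_point_cball:
  fixes h :: "'a::euclidean_space \<Rightarrow> 'b::real_normed_vector"
  assumes "0 \<le> W" "0 \<le> L"
    and "\<And>x. (h has_derivative h' x) (at x)"
    and "\<And>x. norm x \<le> W \<Longrightarrow> onorm (h' x) \<le> L"
  shows "L-lipschitz_on UNIV (\<lambda>x. h (closest_point (cball 0 W) x))"
proof (rule lipschitz_onI)
  fix x y
  let ?P = "closest_point (cball 0 W)"
  have P: "?P x \<in> cball 0 W" for x
    using \<open>0 \<le> W\<close> by (intro closest_point_in_set) auto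
  have "norm (h (?P x) - h (?P y)) \<le> L * norm (?P x - ?P y)"
    by (rule differentiable_bound[OF convex_cball _ _ P P, where f' = h'])
      (use assms in \<open>auto intro: has_derivative_at_withinI\<close>)
  also have "\<dots> \<le> L * norm (x - y)"
    using closest_point_lipschitz[of "cball (0::'a) W" x y] assms
    by (intro mult_left_mono) (auto simp: dist_norm)
  finally show "dist (h (?P x)) (h (?P y)) \<le> L * dist x y"
    by (simp add: dist_norm)
qed (rule \<open>0 \<le> L\<close>)

text \<open>The projection is nonexpansive and fixes 0. This lets the truncated nonlinearity inherit
  a growth bound in \<open>norm x\<close>.\<close>

lemma norm_closest_point_cball_le:
  fixes x :: "'a::euclidean_space"
  assumes "0 \<le> W"
  shows "norm (closest_point (cball 0 W) x) \<le> norm x"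
proof -
  have "closest_point (cball (0::'a) W) 0 = 0"
    using assms by (intro closest_point_self) auto
  then show ?thesis
    using closest_point_lipschitz[of "cball (0::'a) W" x 0] assms by auto
qed

text \<open>
  The truncation \<open>h \<circ> closest_point (cball 0 W)\<close> keeps the growth bound on \<open>h\<close>, so the decay
  estimate applies to its solutions as well and shows that the truncation never acts on them.
\<close>

lemma solution_extends_with_decay:
  fixes h :: "'a::euclidean_space \<Rightarrow> 'a"
  assumes "p < a" "0 < W" "c * (W powr b + 1) \<le> (a - p) * W" "0 \<le> c" "1 \<le> b" "0 \<le> p" "p \<le> a1"
    and L: "c * W powr (b - 1) < a" and W: "c < a * W"
    and dh: "\<And>x. (h has_derivative h' x) (at x)"
    and h_le: "\<And>x. norm (h x) \<le> c * norm x powr b"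
    and h'_le: "\<And>x. onorm (h' x) \<le> c * norm x powr (b - 1)"
    and df: "\<And>s. 0 \<le> s \<Longrightarrow> (f has_vector_derivative f' s) (at s within {0..})"
    and f_le: "\<And>s. 0 \<le> s \<Longrightarrow> norm (f' s) + a * norm (f s) \<le> c * exp (- a1 * s)"
    and u: "solution a h f \<tau> u"
  shows "\<exists>v. (\<forall>t\<in>time_dom \<tau>. v t = u t) \<and> solution a h f \<infinity> v \<and> (\<forall>t\<ge>0. norm (v t) \<le> W * exp (- p * t))"
proof -
  define P where "P = closest_point (cball (0::'a) W)"
  define L where "L = c * W powr (b - 1)"
  have a: "0 < a" using assms by simp
  have L0: "0 \<le> L" using assms by (simp add: L_def)
  have P_le: "norm (P x) \<le> W" "norm (P x) \<le> norm x" for x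
    using closest_point_in_set[of "cball (0::'a) W" x] norm_closest_point_cball_le[of W x] assms
    by (auto simp: P_def)
  have P_id: "P x = x" if "norm x \<le> W" for x
    using that by (simp add: P_def closest_point_self)
  have "onorm (h' x) \<le> L" if "norm x \<le> W" for x
  proof -
    have "c * norm x powr (b - 1) \<le> c * W powr (b - 1)"
      using that assms by (intro mult_left_mono powr_mono2) auto
    then show ?thesis using h'_le[of x] by (simp add: L_def)
  qed
  then have lip: "L-lipschitz_on UNIV (\<lambda>x. h (P x))"
    unfolding P_def using assms L0 by (intro lipschitz_closest_point_cball) auto
  have hP_le: "norm (h (P x)) \<le> c * norm x powr b" for x
  proof -
    have "c * norm (P x) powr b \<le> c * norm x powr b"
      using P_le assms by (intro mult_left_mono powr_mono2) auto
    then show ?thesis using h_le[of "P x"] by simp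
  qed
  \<comment> \<open>Besides growth, the fixed point argument needs a bound uniform in
    \<open>x\<close>, which truncation provides.\<close>
  have hP_bd: "norm (h (P x)) \<le> c * W powr b" for x
  proof -
    have "c * norm (P x) powr b \<le> c * W powr b"
      using P_le assms by (intro mult_left_mono powr_mono2) auto
    then show ?thesis using h_le[of "P x"] by simp
  qed
  have f_le': "norm (f t) \<le> c / a" if "0 \<le> t" for t
  proof -
    have "a * norm (f t) \<le> c * exp (- a1 * t)"
      using f_le[OF that] norm_ge_zero[of "f' t"] by linarith
    also have "\<dots> \<le> c * 1"
      using assms that by (intro mult_left_mono) auto
    finally show ?thesis using a by (simp add: field_simps)
  qed
  have "c / a < W" using W a by (simp add: field_simps)
  then have f0: "norm (f 0) < W" using f_le'[of 0] by simp
  have cf: "continuous_on {0..} f"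
    unfolding continuous_on_eq_continuous_within
    by (metis atLeast_iff df has_vector_derivative_continuous)
  have ch: "continuous_on UNIV h"
    using dh has_derivative_continuous continuous_at_imp_continuous_on by blast
  \<comment> \<open>Stated for a general \<open>g\<close> because it is used twice: with the
    truncated nonlinearity for \<open>v\<close>, and with \<open>h\<close> itself for
    \<open>u\<close>.\<close>
  have decay: "norm (w t) < W * exp (- p * t)"
    if "continuous_on {0..t} w" "0 \<le> t" "continuous_on UNIV g"
      "\<And>x. norm (g x) \<le> c * norm x powr b"
      "\<And>s. s \<in> {0..t} \<Longrightarrow> w s = integral {0..s} (\<lambda>r. exp (- a * (s - r)) *\<^sub>R g (w r)) + f s"
    for w t g
    by (rule exp_decay_bound[OF assms(1) _ assms(3-7) that(1,3,5) df f0 f_le that(4)])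
      (use \<open>0 < W\<close> \<open>0 \<le> t\<close> in auto)
  have exp_p: "W * exp (- p * t) \<le> W" if "0 \<le> t" for t
    using assms that by (simp add: mult_left_le)
  have "L < a" using L by (simp add: L_def)
  obtain v where cv: "continuous_on {0..} v"
    and v: "\<And>t. 0 \<le> t \<Longrightarrow> v t = integral {0..t} (\<lambda>s. exp (- a * (t - s)) *\<^sub>R h (P (v s))) + f t"
    using exp_kernel_global_existence[OF L0 \<open>L < a\<close> lip hP_bd cf f_le'] by blast
  have v_le: "norm (v t) < W * exp (- p * t)" if "0 \<le> t" for t
    by (rule decay[OF _ that lipschitz_on_continuous_on[OF lip] hP_le v])
      (auto intro: continuous_on_subset[OF cv])
  \<comment> \<open>A function obeying the decay bound stays in the ball of radius \<open>W\<close>,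
    where \<open>P\<close> is the identity, so the original and truncated equations agree along
    it.\<close>
  have hP: "integral {0..t} (\<lambda>s. exp (- a * (t - s)) *\<^sub>R h (P (w s)))
      = integral {0..t} (\<lambda>s. exp (- a * (t - s)) *\<^sub>R h (w s))"
    if "\<And>s. s \<in> {0..t} \<Longrightarrow> norm (w s) < W * exp (- p * s)" for w t
  proof (rule integral_cong)
    fix s assume s: "s \<in> {0..t}"
    then have "norm (w s) \<le> W"
      using that[OF s] exp_p[of s] by simp
    then show "exp (- a * (t - s)) *\<^sub>R h (P (w s)) = exp (- a * (t - s)) *\<^sub>R h (w s)"
      by (simp add: P_id)
  qed
  have "solution a h f \<infinity> v"
  proof -
    have "time_dom \<infinity> = {0..}" by (auto simp: time_dom_def)
    moreover have "v t = integral {0..t} (\<lambda>s. exp (- a * (t - s)) *\<^sub>R h (v s)) + f t" if "0 \<le> t" for t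
      by (subst v[OF that], subst hP) (use v_le in auto)
    ultimately show ?thesis using cv by (simp add: solution_def)
  qed
  \<comment> \<open>By the decay bound \<open>u\<close> also solves the truncated equation on
    \<open>{0..t}\<close>, so uniqueness for that equation identifies it with
    \<open>v\<close>.\<close>
  moreover have "v t = u t" if t: "t \<in> time_dom \<tau>" for t
  proof -
    have dom: "{0..t} \<subseteq> time_dom \<tau>"
      using t by (auto simp: time_dom_def intro: le_less_trans[of "ereal _" "ereal t"])
    have cu: "continuous_on {0..t} u"
      using u dom by (auto simp: solution_def intro: continuous_on_subset)
    have u_eq: "u s = integral {0..s} (\<lambda>r. exp (- a * (s - r)) *\<^sub>R h (u r)) + f s" if "s \<in> {0..t}" for s
      using u dom that unfolding solution_def by blast
    have u_le: "norm (u s) < W * exp (- p * s)" if "s \<in> {0..t}" for s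
      by (rule decay[OF _ _ ch h_le u_eq])
        (use that in \<open>auto intro: continuous_on_subset[OF cu]\<close>)
    show ?thesis
    proof (rule exp_kernel_unique[OF L0 \<open>L < a\<close> lip _ cu, where f = f])
      show "u s = integral {0..s} (\<lambda>r. exp (- a * (s - r)) *\<^sub>R h (P (u r))) + f s" if "s \<in> {0..t}" for s
        using u_eq[OF that] hP[of s u] u_le that by simp
      show "v s = integral {0..s} (\<lambda>r. exp (- a * (s - r)) *\<^sub>R h (P (v r))) + f s" if "s \<in> {0..t}" for s
        using v[of s] that by simp
    qed (use t in \<open>auto simp: time_dom_def intro: continuous_on_subset[OF cv]\<close>)
  qed
  ultimately show ?thesis using v_le by (blast intro: less_imp_le)
qed

section \<open>The constants, and the real and complex cases\<close>

text \<open>Checks that \<open>W = inverse R\<close> meets the conditions of the extension result.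
  Everything rests on \<open>1 \<le> R\<close>, \<open>R powr b = b - 1\<close> and
  \<open>R * b \<le> 2 * (b - 1)\<close>.\<close>

lemma decay_amplitude:
  fixes a b c p R :: real
  assumes "a \<ge> 2" "b \<ge> 2" "0 < c" "c < 0.75" "R = (b - 1) powr (1 / b)" "p < 0.25 * a"
  shows "0 < inverse R" and "c * (inverse R powr b + 1) \<le> (a - p) * inverse R"
    and "c * inverse R powr (b - 1) < a" and "c < a * inverse R"
proof -
  have R1: "1 \<le> R"
    using assms by (simp add: ge_one_powr_ge_zero)
  then show "0 < inverse R" by simp
  \<comment> \<open>Weighted AM-GM for \<open>b - 1\<close> and 1 with weights \<open>1 / b\<close>
    and \<open>1 - 1 / b\<close>.\<close>
  have "R \<le> 1 / b * (b - 1) + (1 - 1 / b) * 1"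
    using Youngs_inequality_0[of "1 / b" "1 - 1 / b" "b - 1" 1] assms by simp
  also have "\<dots> = 2 * (b - 1) / b" using assms by (simp add: field_simps)
  finally have R2: "R * b \<le> 2 * (b - 1)" using assms by (simp add: field_simps)
  have "R powr b = b - 1" using assms by (simp add: powr_powr)
  then have pow: "inverse R powr b + 1 = b / (b - 1)"
    unfolding inverse_powr using assms(2) R1 by (simp add: field_simps)
  have "c * b * R \<le> c * (2 * (b - 1))"
    using R2 assms mult_left_mono[of "R * b" "2 * (b - 1)" c] by (simp add: mult_ac)
  \<comment> \<open>The numerical hypotheses meet here:
    \<open>2 * c < 1.5 \<le> 0.75 * a < a - p\<close>.\<close>
  also have "\<dots> \<le> (a - p) * (b - 1)"
    using assms mult_right_mono[of "c * 2" "a - p" "b - 1"] by (simp add: mult_ac)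
  finally show "c * (inverse R powr b + 1) \<le> (a - p) * inverse R"
    using assms R1 unfolding pow by (simp add: field_simps)
  have "inverse R powr (b - 1) \<le> 1"
    using R1 assms by (intro powr_le1) (auto simp: inverse_le_1_iff)
  then have "c * inverse R powr (b - 1) \<le> c * 1"
    using assms by (intro mult_left_mono) auto
  then show "c * inverse R powr (b - 1) < a" using assms(1,4) by simp
  have "R * b \<le> 2 * b" using R2 by simp
  then have "R \<le> 2" using assms by simp
  then have "c * R \<le> c * 2" using \<open>0 < c\<close> by (intro mult_left_mono) auto
  then have "c * R < a" using assms(1,4) by simp
  then show "c < a * inverse R" using R1 by (simp add: field_simps)
qed

text \<open>Both fields are instances of the Euclidean-space extension result. In the complex case
  \<open>h'\<close> takes values in the bounded real-linear maps, so its norm is the operator norm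
  of the derivative on the plane.\<close>

theorem theorem2:
  fixes a b a1 c p R :: real
  assumes "a \<ge> 2" and "b \<ge> 2" and "a1 > 0" and "0 < c" and "c < 0.75"
    and "R = (b - 1) powr (1 / b)"
    and "0 < p" and "p < min (0.25 * a) a1"
  shows
    "(\<forall>(h :: real \<Rightarrow> real) (h' :: real \<Rightarrow> real) (f :: real \<Rightarrow> real) (f' :: real \<Rightarrow> real).
        (\<forall>x. (h has_real_derivative h' x) (at x)) \<and> continuous_on UNIV h' \<and>
        (\<forall>x. \<bar>h x\<bar> \<le> c * \<bar>x\<bar> powr b) \<and>
        (\<forall>x. \<bar>h' x\<bar> \<le> c * \<bar>x\<bar> powr (b - 1)) \<and>
        (\<forall>t\<ge>0. (f has_real_derivative f' t) (at t within {0..})) \<and> continuous_on {0..} f' \<and>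
        (\<forall>t\<ge>0. \<bar>f' t\<bar> + a * \<bar>f t\<bar> \<le> c * exp (- a1 * t)) \<longrightarrow>
        (\<forall>\<tau> u. 0 < \<tau> \<and> solution a h f \<tau> u \<longrightarrow>
           (\<exists>v. (\<forall>t\<in>time_dom \<tau>. v t = u t) \<and> solution a h f \<infinity> v \<and>
                (\<forall>t\<ge>0. \<bar>v t\<bar> \<le> inverse R * exp (- p * t)))))
     \<and>
     (\<forall>(h :: complex \<Rightarrow> complex) (h' :: complex \<Rightarrow> complex \<Rightarrow>\<^sub>L complex)
        (f :: real \<Rightarrow> complex) (f' :: real \<Rightarrow> complex).
        (\<forall>x. (h has_derivative blinfun_apply (h' x)) (at x)) \<and> continuous_on UNIV h' \<and>
        (\<forall>x. norm (h x) \<le> c * norm x powr b) \<and>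
        (\<forall>x. norm (h' x) \<le> c * norm x powr (b - 1)) \<and>
        (\<forall>t\<ge>0. (f has_vector_derivative f' t) (at t within {0..})) \<and> continuous_on {0..} f' \<and>
        (\<forall>t\<ge>0. norm (f' t) + a * norm (f t) \<le> c * exp (- a1 * t)) \<longrightarrow>
        (\<forall>\<tau> u. 0 < \<tau> \<and> solution a h f \<tau> u \<longrightarrow>
           (\<exists>v. (\<forall>t\<in>time_dom \<tau>. v t = u t) \<and> solution a h f \<infinity> v \<and>
                (\<forall>t\<ge>0. norm (v t) \<le> inverse R * exp (- p * t)))))"
proof (intro conjI allI impI; (elim conjE)?)
  have p: "p < a" "p < 0.25 * a" "0 \<le> p" "p \<le> a1" "0 \<le> c" "1 \<le> b" using assms by auto
  note amp = decay_amplitude[OF assms(1,2,4,5,6) p(2)]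
  {
    fix h h' f f' :: "real \<Rightarrow> real" and \<tau> u
    assume h: "\<forall>x. (h has_real_derivative h' x) (at x)" "\<forall>x. \<bar>h x\<bar> \<le> c * \<bar>x\<bar> powr b"
        "\<forall>x. \<bar>h' x\<bar> \<le> c * \<bar>x\<bar> powr (b - 1)"
      and f: "\<forall>t\<ge>0. (f has_real_derivative f' t) (at t within {0..})"
        "\<forall>t\<ge>0. \<bar>f' t\<bar> + a * \<bar>f t\<bar> \<le> c * exp (- a1 * t)"
      and u: "solution a h f \<tau> u"
    \<comment> \<open>The scalar derivative becomes multiplication by \<open>h' x\<close>, whose
      operator norm is controlled by the absolute value.\<close>
    have "onorm ((*) (h' x)) \<le> \<bar>h' x\<bar>" for x
      by (rule onorm_bound) (auto simp: abs_mult)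
    then have h'_le: "onorm ((*) (h' x)) \<le> c * norm x powr (b - 1)" for x
      using h(3) unfolding real_norm_def by (meson order_trans)
    have dh: "(h has_derivative (*) (h' x)) (at x)" for x
      using h(1) by (simp add: has_field_derivative_def)
    have df: "(f has_vector_derivative f' s) (at s within {0..})" if "0 \<le> s" for s
      using f(1) that by (simp add: has_real_derivative_iff_has_vector_derivative)
    show "\<exists>v. (\<forall>t\<in>time_dom \<tau>. v t = u t) \<and> solution a h f \<infinity> v \<and>
        (\<forall>t\<ge>0. \<bar>v t\<bar> \<le> inverse R * exp (- p * t))"
      unfolding real_norm_def[symmetric]
      by (rule solution_extends_with_decay[OF p(1) amp(1,2) p(5,6,3,4) amp(3,4) dh _ h'_le df _ u])
        (use h(2) f(2) in auto)
  next
    fix h and h' :: "complex \<Rightarrow> complex \<Rightarrow>\<^sub>L complex" and f f' :: "real \<Rightarrow> complex" and \<tau> u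
    assume h: "\<forall>x. (h has_derivative blinfun_apply (h' x)) (at x)"
        "\<forall>x. norm (h x) \<le> c * norm x powr b" "\<forall>x. norm (h' x) \<le> c * norm x powr (b - 1)"
      and f: "\<forall>t\<ge>0. (f has_vector_derivative f' t) (at t within {0..})"
        "\<forall>t\<ge>0. norm (f' t) + a * norm (f t) \<le> c * exp (- a1 * t)"
      and u: "solution a h f \<tau> u"
    show "\<exists>v. (\<forall>t\<in>time_dom \<tau>. v t = u t) \<and> solution a h f \<infinity> v \<and>
        (\<forall>t\<ge>0. norm (v t) \<le> inverse R * exp (- p * t))"
      by (rule solution_extends_with_decay[OF p(1) amp(1,2) p(5,6,3,4) amp(3,4)
            h(1)[rule_format] h(2)[rule_format] h(3)[rule_format, unfolded norm_blinfun.rep_eq]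
            f(1)[rule_format] f(2)[rule_format] u])
  }
qed

end
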